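(* Let $r \ge 1$ and $k_1, \dots, k_r \ge 2$ be integers, and let $m \ge 2$ be an integer. If there exists a linear Ramsey $(k_1, k_2, \dots, k_r; m)$-graph $U$, then there exists a cyclic Ramsey $(k_1, k_2, \dots, k_r, 3; 3m-1)$-graph $W$.
   Context: Let $U$ be the complete graph $K_m$ on vertices $u_0, \dots, u_{m-1}$. A $q$-colouring of $U$ assigns to each edge one of the colours $1, \dots, q$. The length of the edge $(u_i,u_j)$ is $|j-i|$. A colouring is linear if the colour of every edge depends only on its length; write $c(l)$ for the colour of edges of length $l$ ($1 \le l \le m-1$). A colouring is cyclic if it is linear and $c(l) = c(m-l)$ for all $1 \le l \le m-1$. A Ramsey $(k_1, \dots, k_r; m)$-graph (with all $k_s \ge 2$) is the complete graph $K_m$ with an $r$-colouring of its edges such that, for each colour $s$ with $1 \le s \le r$, there is no complete subgraph on $k_s$ (or more) vertices all of whose edges have colour $s$. A linear (resp. cyclic) Ramsey graph is one whose colouring is linear (resp. cyclic) with respect to some ordering of its vertices. *)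

theory Defs
  imports "HOL-Library.Ramsey"
begin

text \<open>
  An edge of the complete graph on \<open>V\<close> is a two-element subset of \<open>V\<close>, i.e. an element of
  \<^term>\<open>nsets V 2\<close>. Only the values of a colouring \<open>f\<close> on these sets are relevant.
\<close>

definition edge_colouring :: "nat \<Rightarrow> 'a set \<Rightarrow> ('a set \<Rightarrow> nat) \<Rightarrow> bool" where
  "edge_colouring q V f \<longleftrightarrow> (\<forall>e \<in> nsets V 2. f e \<in> {1..q})"

definition vertex_ordering :: "nat \<Rightarrow> 'a set \<Rightarrow> (nat \<Rightarrow> 'a) \<Rightarrow> bool" where
  "vertex_ordering m V u \<longleftrightarrow> bij_betw u {..<m} V"

text \<open>The function \<open>c\<close> gives the colour of the edges of each length; only lengths between
  1 and \<open>m - 1\<close> occur.\<close>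

definition colour_by_length ::
  "nat \<Rightarrow> (nat \<Rightarrow> 'a) \<Rightarrow> ('a set \<Rightarrow> nat) \<Rightarrow> (nat \<Rightarrow> nat) \<Rightarrow> bool" where
  "colour_by_length m u f c \<longleftrightarrow> (\<forall>i j. i < j \<and> j < m \<longrightarrow> f {u i, u j} = c (j - i))"

definition linear_colouring :: "nat \<Rightarrow> (nat \<Rightarrow> 'a) \<Rightarrow> ('a set \<Rightarrow> nat) \<Rightarrow> bool" where
  "linear_colouring m u f \<longleftrightarrow> (\<exists>c. colour_by_length m u f c)"

definition cyclic_colouring :: "nat \<Rightarrow> (nat \<Rightarrow> 'a) \<Rightarrow> ('a set \<Rightarrow> nat) \<Rightarrow> bool" where
  "cyclic_colouring m u f \<longleftrightarrow>
     (\<exists>c. colour_by_length m u f c \<and> (\<forall>l \<in> {1..m - 1}. c l = c (m - l)))"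

text \<open>The clique bound for colour \<open>s\<close>, with colours numbered from 1, is \<open>ks ! (s - 1)\<close>.\<close>

definition ramsey_graph :: "nat list \<Rightarrow> nat \<Rightarrow> 'a set \<Rightarrow> ('a set \<Rightarrow> nat) \<Rightarrow> bool" where
  "ramsey_graph ks m V f \<longleftrightarrow>
     finite V \<and> card V = m \<and> edge_colouring (length ks) V f \<and>
     (\<forall>s \<in> {1..length ks}.
        \<not> (\<exists>K \<subseteq> V. card K \<ge> ks ! (s - 1) \<and> (\<forall>e \<in> nsets K 2. f e = s)))"

definition linear_ramsey_graph :: "nat list \<Rightarrow> nat \<Rightarrow> 'a set \<Rightarrow> ('a set \<Rightarrow> nat) \<Rightarrow> bool" where
  "linear_ramsey_graph ks m V f \<longleftrightarrow>
     ramsey_graph ks m V f \<and> (\<exists>u. vertex_ordering m V u \<and> linear_colouring m u f)"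

definition cyclic_ramsey_graph :: "nat list \<Rightarrow> nat \<Rightarrow> 'a set \<Rightarrow> ('a set \<Rightarrow> nat) \<Rightarrow> bool" where
  "cyclic_ramsey_graph ks m V f \<longleftrightarrow>
     ramsey_graph ks m V f \<and> (\<exists>u. vertex_ordering m V u \<and> cyclic_colouring m u f)"

end

theory Submission
  imports Defs
begin

text \<open>
  Put \<open>M = 3 m - 1\<close>. Edges of length \<open>l < m\<close> keep the colour \<open>c l\<close>, lengths \<open>m \<le> l < 2 m\<close> receive
  the new colour, and the remaining lengths receive \<open>c (M - l)\<close>. The new colour is triangle-free
  since two lengths that are at least \<open>m\<close> add up to at least \<open>2 m\<close>. In a clique of an old colour
  all cyclic distances are at most \<open>m - 1\<close>; three of them cannot add up to \<open>M\<close>, so the clique does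
  not wind around the circle. It lies in an arc of \<open>m\<close> consecutive vertices, which is a copy of
  the linear graph.
\<close>

definition cyclic_extension :: "nat \<Rightarrow> nat \<Rightarrow> (nat \<Rightarrow> nat) \<Rightarrow> nat \<Rightarrow> nat" where
  "cyclic_extension m q c l =
     (if l < m then c l else if l < 2 * m then q else c (3 * m - 1 - l))"

text \<open>Reflection in \<open>3 * m - 1\<close> exchanges the lengths \<open>1..m - 1\<close>
  with \<open>2 * m..3 * m - 2\<close> and maps the middle range \<open>m..2 * m - 1\<close> to
  itself.\<close>

lemma cyclic_extension_symmetric:
  assumes "l \<in> {1..3 * m - 1 - 1}"
  shows "cyclic_extension m q c l = cyclic_extension m q c (3 * m - 1 - l)"
  using assms by (auto simp: cyclic_extension_def)

lemma cyclic_extension_old_colour: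
  assumes "cyclic_extension m q c l = s" "s \<noteq> q" "l < 3 * m - 1"
  shows "l < m \<and> c l = s \<or> 2 * m \<le> l \<and> c (3 * m - 1 - l) = s"
  using assms by (auto simp: cyclic_extension_def split: if_splits)

text \<open>Lengths are invariant under translation, so \<open>K\<close> may be any finite set of
  naturals: moving its minimum to 0 puts it inside \<open>{..<m}\<close>, where \<open>u\<close>
  carries it to a forbidden clique.\<close>

lemma ramsey_graph_no_length_clique:
  assumes ram: "ramsey_graph ks m V f"
    and ord: "vertex_ordering m V u"
    and col: "colour_by_length m u f c"
    and "0 < m"
    and s: "s \<in> {1..length ks}"
    and K: "finite K" "K \<noteq> {}" "card K \<ge> ks ! (s - 1)"
    and clique: "\<And>i j. i \<in> K \<Longrightarrow> j \<in> K \<Longrightarrow> i < j \<Longrightarrow> j - i < m \<and> c (j - i) = s"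
  shows False
proof -
  define y where "y = Min K"
  have y: "y \<in> K" "\<And>i. i \<in> K \<Longrightarrow> y \<le> i"
    using K by (auto simp: y_def)
  have u: "inj_on u {..<m}" "u ` {..<m} = V"
    using ord by (auto simp: vertex_ordering_def bij_betw_def)
  have less: "i - y < m" if "i \<in> K" for i
    using clique[of y i] y that \<open>0 < m\<close> by (cases "i = y") (auto simp: le_less)
  have inj: "inj_on (\<lambda>i. u (i - y)) K"
  proof (rule inj_onI)
    fix i j assume ij: "i \<in> K" "j \<in> K" "u (i - y) = u (j - y)"
    then have "i - y = j - y" using inj_onD[OF u(1)] less by auto
    then show "i = j" using y(2)[OF ij(1)] y(2)[OF ij(2)] by simp
  qed
  have edge: "f {u (i - y), u (j - y)} = s" if "i \<in> K" "j \<in> K" "i < j" for i j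
  proof -
    have "i - y < j - y" "j - y - (i - y) = j - i"
      using that y(2)[of i] by auto
    with col less[OF that(2)] clique[OF that] show ?thesis
      by (auto simp: colour_by_length_def)
  qed
  have "\<forall>e \<in> nsets ((\<lambda>i. u (i - y)) ` K) 2. f e = s"
  proof
    fix e assume "e \<in> nsets ((\<lambda>i. u (i - y)) ` K) 2"
    then obtain i j where ij: "i \<in> K" "j \<in> K" "i \<noteq> j" "e = {u (i - y), u (j - y)}"
      by (auto simp: nsets_2_eq)
    then show "f e = s"
      using edge[of i j] edge[of j i] by (auto simp: neq_iff insert_commute)
  qed
  moreover have "(\<lambda>i. u (i - y)) ` K \<subseteq> V"
    using u(2) less by auto
  moreover have "card ((\<lambda>i. u (i - y)) ` K) \<ge> ks ! (s - 1)"
    using K inj by (simp add: card_image)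
  ultimately show False
    using ram s unfolding ramsey_graph_def by blast
qed

text \<open>Cuts the circle open at the gap that every clique of an old colour leaves. Positions in
  \<open>L\<close> may exceed \<open>3 * m - 2\<close>, since only their differences matter.\<close>

lemma cyclic_extension_unwind_clique:
  assumes K: "K \<subseteq> {..<3 * m - 1}" "K \<noteq> {}" and s: "s \<noteq> q"
    and clique: "\<And>i j. i \<in> K \<Longrightarrow> j \<in> K \<Longrightarrow> i < j \<Longrightarrow> cyclic_extension m q c (j - i) = s"
  obtains L where "finite L" "L \<noteq> {}" "card L = card K"
    "\<And>i j. i \<in> L \<Longrightarrow> j \<in> L \<Longrightarrow> i < j \<Longrightarrow> j - i < m \<and> c (j - i) = s"
proof -
  have fin: "finite K" using K(1) finite_subset by blast
  define x where "x = Min K"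
  have x: "x \<in> K" "\<And>i. i \<in> K \<Longrightarrow> x \<le> i"
    using fin K by (auto simp: x_def)
  \<comment> \<open>Seen from \<open>x\<close>, vertices are near (offset below \<open>m\<close>) or
    far (offset at least \<open>2 * m\<close>). A full turn added to the near ones places them just
    after the far ones.\<close>
  define h where "h i = (if i - x < m then i + (3 * m - 1) else i)" for i
  have old: "j - i < m \<and> c (j - i) = s \<or> 2 * m \<le> j - i \<and> c (3 * m - 1 - (j - i)) = s"
    if "i \<in> K" "j \<in> K" "i < j" for i j
    using cyclic_extension_old_colour[OF clique[OF that] s] that K(1) by fastforce
  have far: "2 * m \<le> i - x" if "i \<in> K" "\<not> i - x < m" for i
    using old[of x i] x that by (cases "i = x") (auto simp: le_less)
  have bound: "i < 3 * m - 1" if "i \<in> K" for i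
    using that K(1) by auto
  have inj: "inj_on h K"
    by (rule inj_onI) (auto simp: h_def split: if_splits dest!: bound)
  have "h j - h i < m \<and> c (h j - h i) = s" if ij: "i \<in> K" "j \<in> K" "h i < h j" for i j
  proof (cases "i - x < m"; cases "j - x < m")
    assume *: "i - x < m" "j - x < m"
    then have "i < j" "h j - h i = j - i" "j - i < m"
      using ij(3) x(2)[OF ij(1)] by (auto simp: h_def)
    with old[OF ij(1,2)] show ?thesis by auto
  next
    \<comment> \<open>Impossible: the full turn puts \<open>h i\<close> beyond every far
      vertex.\<close>
    assume "i - x < m" "\<not> j - x < m"
    with ij bound[OF ij(2)] show ?thesis by (auto simp: h_def)
  next
    assume *: "\<not> i - x < m" "j - x < m"
    then have "2 * m \<le> i - x" using far ij by blast
    \<comment> \<open>Being at least \<open>m\<close>, the length \<open>i - j\<close> must by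
      \<open>old\<close> be at least \<open>2 * m\<close>; its reflection, the new distance, is then
      below \<open>m\<close>.\<close>
    then have "j < i" "m \<le> i - j" using * x(2)[OF ij(2)] by auto
    moreover have "h j - h i = 3 * m - 1 - (i - j)"
      using * bound[OF ij(1)] \<open>j < i\<close> by (auto simp: h_def)
    ultimately show ?thesis
      using old[OF ij(2,1)] bound[OF ij(1)] by auto
  next
    \<comment> \<open>Far vertices all lie between \<open>x + 2 * m\<close> and
      \<open>3 * m - 2\<close>, which excludes the long alternative in \<open>old\<close>.\<close>
    assume *: "\<not> i - x < m" "\<not> j - x < m"
    then have "2 * m \<le> i - x" using far ij by blast
    with * ij bound[OF ij(2)] old[OF ij(1,2)] show ?thesis by (auto simp: h_def)
  qed
  then show thesis
    using that[of "h ` K"] fin K(2) inj by (auto simp: card_image)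
qed

lemma cyclic_extension_no_triangle:
  assumes c: "\<And>l. 1 \<le> l \<Longrightarrow> l < m \<Longrightarrow> c l \<noteq> q"
    and K: "K \<subseteq> {..<3 * m - 1}" "card K \<ge> 3"
    and clique: "\<And>i j. i \<in> K \<Longrightarrow> j \<in> K \<Longrightarrow> i < j \<Longrightarrow> cyclic_extension m q c (j - i) = q"
  shows False
proof -
  \<comment> \<open>As \<open>c\<close> avoids \<open>q\<close> on the lengths that occur, only the
    middle range can carry the colour \<open>q\<close>.\<close>
  have mid: "m \<le> j - i \<and> j - i < 2 * m" if "i \<in> K" "j \<in> K" "i < j" for i j
  proof -
    have "j < 3 * m - 1" using that K(1) by auto
    then have "1 \<le> j - i" "1 \<le> 3 * m - 1 - (j - i)" using that(3) by auto
    then show ?thesis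
      using clique[OF that] c[of "j - i"] c[of "3 * m - 1 - (j - i)"]
      by (auto simp: cyclic_extension_def split: if_splits)
  qed
  have no: False if "a \<in> K" "b \<in> K" "d \<in> K" "a < b" "b < d" for a b d
    using mid[of a b] mid[of b d] mid[of a d] that by auto
  obtain T where "T \<subseteq> K" "card T = 3"
    using K(2) by (meson obtain_subset_with_card_n)
  then obtain a b d where "a \<in> K" "b \<in> K" "d \<in> K" "a \<noteq> b" "a \<noteq> d" "b \<noteq> d"
    by (auto simp: card_3_iff)
  then show False
    using no by (meson linorder_neqE_nat)
qed

theorem theorem1:
  fixes ks :: "nat list" and m :: nat
  assumes "length ks \<ge> 1"
    and "\<forall>k \<in> set ks. k \<ge> 2"
    and "m \<ge> 2"
    and "\<exists>(U :: 'a set) f. linear_ramsey_graph ks m U f"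
  shows "\<exists>(W :: nat set) g. cyclic_ramsey_graph (ks @ [3]) (3 * m - 1) W g"
proof -
  obtain U :: "'a set" and f u c where ram: "ramsey_graph ks m U f"
    and ord: "vertex_ordering m U u" and col: "colour_by_length m u f c"
    using assms(4) by (auto simp: linear_ramsey_graph_def linear_colouring_def)
  define q where "q = Suc (length ks)"
  define C where "C = cyclic_extension m q c"
  define W where "W = {..<3 * m - 1}"
  \<comment> \<open>Maximum minus minimum recovers the length of an edge from the unordered
    pair.\<close>
  define g :: "nat set \<Rightarrow> nat" where "g e = C (Max e - Min e)" for e
  have g: "g {i, j} = C (j - i)" if "i < j" for i j
    using that by (simp add: g_def max_def min_def)
  \<comment> \<open>Each length below \<open>m\<close> is realised by an edge at \<open>u 0\<close>,
    so \<open>c\<close> takes only genuine colours there.\<close>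
  have c_range: "c l \<in> {1..length ks}" if "1 \<le> l" "l < m" for l
  proof -
    have "u 0 \<noteq> u l" "u 0 \<in> U" "u l \<in> U"
      using ord that by (auto simp: vertex_ordering_def bij_betw_def inj_on_def)
    then have "{u 0, u l} \<in> nsets U 2" by simp
    then have "f {u 0, u l} \<in> {1..length ks}"
      using ram unfolding ramsey_graph_def edge_colouring_def by blast
    moreover have "f {u 0, u l} = c l"
      using col that by (auto simp: colour_by_length_def)
    ultimately show ?thesis by simp
  qed
  have C_range: "C l \<in> {1..q}" if "1 \<le> l" "l < 3 * m - 1" for l
  proof -
    have "l < 2 * m \<or> 1 \<le> 3 * m - 1 - l \<and> 3 * m - 1 - l < m"
      using that by auto
    then show ?thesis
      using c_range[of l] c_range[of "3 * m - 1 - l"] that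
      by (fastforce simp: C_def cyclic_extension_def q_def)
  qed
  have "edge_colouring q W g"
    unfolding edge_colouring_def
  proof
    fix e assume "e \<in> nsets W 2"
    then obtain a b where "a \<in> W" "b \<in> W" "a \<noteq> b" "e = {a, b}"
      by (auto simp: nsets_2_eq)
    then obtain i j where "i < j" "j < 3 * m - 1" "e = {i, j}"
      unfolding W_def by (metis insert_commute lessThan_iff linorder_neqE_nat)
    then show "g e \<in> {1..q}" using g C_range[of "j - i"] by auto
  qed
  moreover have False
    if s: "s \<in> {1..q}" and KW: "K \<subseteq> W" and card: "card K \<ge> (ks @ [3]) ! (s - 1)"
      and mono: "\<forall>e \<in> nsets K 2. g e = s" for s K
  proof -
    have clique: "cyclic_extension m q c (j - i) = s" if "i \<in> K" "j \<in> K" "i < j" for i j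
      using mono g[OF that(3)] that by (metis C_def doubleton_in_nsets_2 less_irrefl)
    show False
    proof (cases "s = q")
      case True
      have "card K \<ge> 3" using card True by (simp add: q_def nth_append)
      moreover have "c l \<noteq> q" if "1 \<le> l" "l < m" for l
        using c_range[OF that] by (simp add: q_def)
      ultimately show False
        using cyclic_extension_no_triangle[of m c q K] KW clique True by (simp add: W_def)
    next
      case False
      then have s': "s \<in> {1..length ks}" using s by (auto simp: q_def)
      then have "s - 1 < length ks" by auto
      then have card': "card K \<ge> ks ! (s - 1)" and "ks ! (s - 1) \<in> set ks"
        using card by (auto simp: nth_append)
      \<comment> \<open>A clique bound of at least 2 rules out the empty set, so the unwinding has a
        least vertex to start from.\<close>
      then have "K \<noteq> {}" using assms(2) by force
      show False
      proof (rule cyclic_extension_unwind_clique[OF KW[unfolded W_def] \<open>K \<noteq> {}\<close> False clique])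
        fix L assume L: "finite L" "L \<noteq> {}" "card L = card K"
          and "\<And>i j. i \<in> L \<Longrightarrow> j \<in> L \<Longrightarrow> i < j \<Longrightarrow> j - i < m \<and> c (j - i) = s"
        then show False
          using ramsey_graph_no_length_clique[OF ram ord col _ s' L(1,2)] card' assms(3) by simp
      qed
    qed
  qed
  moreover have "finite W" "card W = 3 * m - 1" "length (ks @ [3]) = q"
    by (simp_all add: W_def q_def)
  ultimately have "ramsey_graph (ks @ [3]) (3 * m - 1) W g"
    unfolding ramsey_graph_def by metis
  moreover have "vertex_ordering (3 * m - 1) W id"
    by (simp add: vertex_ordering_def W_def)
  moreover have "cyclic_colouring (3 * m - 1) id g"
    unfolding cyclic_colouring_def colour_by_length_def
    using g cyclic_extension_symmetric by (intro exI[of _ C]) (auto simp: C_def)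
  ultimately show ?thesis
    unfolding cyclic_ramsey_graph_def by blast
qed

end
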